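(* Let $c>0$ and $\varepsilon>0$ be given. Choose positive integers $W,Q$ (and a partition of $\mathbb{R}$ into $W$ intervals, as in the context) such that $$\dot e_{W}\le\frac{\varepsilon}{2c\,S_{\max}},\qquad \delta_Q\le\frac{\varepsilon}{2c\,(A_{\max}+\dot e_{W})}.$$ Then the optimal values $Z^{\mathrm U}(W,Q)$ and $Z^{\mathrm L}(W,Q)$ of the two approximating models defined in the context satisfy $$0\le Z^{\mathrm U}(W,Q)-Z^{\star}\le\varepsilon,\qquad 0\le Z^{\star}-Z^{\mathrm L}(W,Q)\le\varepsilon,$$ and hence $Z^{\mathrm U}(W,Q)-Z^{\mathrm L}(W,Q)\le 2\varepsilon$.
   Context: **Static stochastic knapsack problem.** There are $n$ items with independent normally distributed weights $\zeta_i$, with means $\mu_i$ and variances $\sigma_i^2$; $\bm{\zeta}$, $\bm{\mu}$, $\bm{\sigma^2}$ are the corresponding vectors. Let $r\in\mathbb{R}^n$ be the given vector of expected item values, $C\in\mathbb{R}$ the knapsack capacity, and $c>0$ the unit shortage cost. The true optimal value is $$Z^\star=\max_{\bm{x}\in\{0,1\}^n}\Big\{r'\bm{x}-c\,\mathrm{E}[\max(\bm{\zeta}'\bm{x}-C,0)]\Big\}.$$ For $\bm{x}\in\{0,1\}^n$ put $M=\bm{x}'\bm{\mu}$ and $V=\bm{x}'\bm{\sigma^2}$. Let $V_{\max}>0$ be an upper bound on $V$ over all $\bm{x}\in\{0,1\}^n$, and $S_{\max}=\sqrt{V_{\max}}$. **Loss linearisation.** Let $Z$ be a standard normal random variable and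 $\mathcal{L}(y,Z)=\mathrm{E}[\max(Z-y,0)]$. Fix a partition of $\mathbb{R}$ into $W$ consecutive (ordered from left to right) intervals $\Omega_1,\dots,\Omega_W$ of positive probability. Let $\dot p_k=\Pr(Z\in\Omega_k)$ and $\dot{\mathrm{E}}[Z\mid\Omega_k]$ be the conditional mean of $Z$ given $Z\in\Omega_k$. The Jensen lower bound is $\mathcal{L}_{\mathrm{lb}}(y,Z)=\sum_{k=1}^W\dot p_k\max(\dot{\mathrm{E}}[Z\mid\Omega_k]-y,0)\le\mathcal{L}(y,Z)$, and $\dot e_W=\max_{y\in\mathbb{R}}\big(\mathcal{L}(y,Z)-\mathcal{L}_{\mathrm{lb}}(y,Z)\big)$ is its maximum approximation error. Define $$A_i=\sum_{k=i}^W\dot p_k\,\dot{\mathrm{E}}[Z\mid\Omega_k]\ \ (i=1,\dots,W),\qquad A_{\max}=\max_{i=1,\dots,W}A_i.$$ **Square-root linearisation.** Let $s=V_{\max}/Q$ and $b_k=ks$ for $k=0,\dots,Q$. Let $\psi_Q:[0,V_{\max}]\to\mathbb{R}$ be the continuous piecewise linear interpolant of $v\mapsto\sqrt v$ at $b_0,\dots,b_Q$, i.e. $\psi_Q(v)=\sqrt{b_{k-1}}+\frac{\sqrt{b_k}-\sqrt{b_{k-1}}}{b_k-b_{k-1}}(v-b_{k-1})$ for $v\in[b_{k-1},b_k]$ (a lower bound of $\sqrt v$). With $\Delta=\sqrt s/4$, the function $\psi_Q+\Delta$ is an upper bound of $\sqrt v$ on $[0,V_{\max}]$. The worst-case deviation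 of either bound from $\sqrt v$ on $[0,V_{\max}]$ is $\delta_Q=\sqrt s/4$. **Approximating models.** - $Z^{\mathrm L}(W,Q)$ (Edmundson–Madanski model, which underestimates the knapsack value) is the maximum of $r'\bm{x}-cP$ over $\bm{x}\in\{0,1\}^n$, $P\in\mathbb{R}$ subject to $M=\bm{x}'\bm{\mu}$, $V=\bm{x}'\bm{\sigma^2}$, $S=\psi_Q(V)+\Delta$, $P\ge S\sum_{k=i}^W\dot p_k\dot{\mathrm{E}}[Z\mid\Omega_k]-(C-M)\sum_{k=i}^W\dot p_k+\dot e_W S$ for $i=1,\dots,W$, and $P\ge\dot e_W S$. - $Z^{\mathrm U}(W,Q)$ (Jensen model, which overestimates the knapsack value) is the maximum of $r'\bm{x}-cP$ over $\bm{x}\in\{0,1\}^n$, $P\in\mathbb{R}$ subject to $M=\bm{x}'\bm{\mu}$, $V=\bm{x}'\bm{\sigma^2}$, $S=\psi_Q(V)$, $P\ge S\sum_{k=i}^W\dot p_k\dot{\mathrm{E}}[Z\mid\Omega_k]-(C-M)\sum_{k=i}^W\dot p_k$ for $i=1,\dots,W$, and $P\ge 0$. *)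

theory Defs
  imports "HOL-Probability.Probability"
begin

definition binary_vecs :: "(real ^ 'n) set" where
  "binary_vecs = {x. \<forall>i. x $ i \<in> {0, 1}}"

text \<open>The normal distribution with mean \<open>m\<close> and standard deviation \<open>s \<ge> 0\<close>.
  Zero variance means a deterministic weight; this case is separate because
  \<^const>\<open>normal_density\<close> is a probability density only for positive standard deviation.\<close>

definition normal_law :: "real \<Rightarrow> real \<Rightarrow> real measure" where
  "normal_law m s = (if s = 0 then return borel m else density lborel (normal_density m s))"

definition variances :: "real ^ 'n \<Rightarrow> real ^ 'n" where
  "variances \<sigma> = (\<chi> i. (\<sigma> $ i)\<^sup>2)"

definition true_value ::
  "'a measure \<Rightarrow> ('a \<Rightarrow> real ^ 'n) \<Rightarrow> real ^ 'n \<Rightarrow> real \<Rightarrow> real \<Rightarrow> real" where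
  "true_value M \<zeta> r c C =
     (MAX x\<in>binary_vecs. r \<bullet> x - c * (\<integral>\<omega>. max (\<zeta> \<omega> \<bullet> x - C) 0 \<partial>M))"


subsection \<open>Linearisation of the standard normal loss function\<close>

definition loss :: "real \<Rightarrow> real" where
  "loss y = (\<integral>z. max (z - y) 0 \<partial>std_normal_distribution)"

definition ordered_interval_partition :: "nat \<Rightarrow> (nat \<Rightarrow> real set) \<Rightarrow> bool" where
  "ordered_interval_partition W \<Omega> \<longleftrightarrow>
     (\<Union>k\<in>{1..W}. \<Omega> k) = UNIV \<and>
     (\<forall>k\<in>{1..W}. is_interval (\<Omega> k)) \<and>
     (\<forall>k\<in>{1..W}. \<forall>l\<in>{1..W}. k < l \<longrightarrow> (\<forall>a\<in>\<Omega> k. \<forall>b\<in>\<Omega> l. a < b)) \<and>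
     (\<forall>k\<in>{1..W}. 0 < measure std_normal_distribution (\<Omega> k))"

definition cell_prob :: "real set \<Rightarrow> real" where
  "cell_prob S = measure std_normal_distribution S"

definition cell_mean :: "real set \<Rightarrow> real" where
  "cell_mean S = (LINT z:S|std_normal_distribution. z) / cell_prob S"

definition loss_lb :: "nat \<Rightarrow> (nat \<Rightarrow> real set) \<Rightarrow> real \<Rightarrow> real" where
  "loss_lb W \<Omega> y = (\<Sum>k=1..W. cell_prob (\<Omega> k) * max (cell_mean (\<Omega> k) - y) 0)"

definition loss_err :: "nat \<Rightarrow> (nat \<Rightarrow> real set) \<Rightarrow> real" where
  "loss_err W \<Omega> = (GREATEST d. \<exists>y. d = loss y - loss_lb W \<Omega> y)"

definition tail_prob :: "nat \<Rightarrow> (nat \<Rightarrow> real set) \<Rightarrow> nat \<Rightarrow> real" where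
  "tail_prob W \<Omega> i = (\<Sum>k=i..W. cell_prob (\<Omega> k))"

definition tail_mean :: "nat \<Rightarrow> (nat \<Rightarrow> real set) \<Rightarrow> nat \<Rightarrow> real" where
  "tail_mean W \<Omega> i = (\<Sum>k=i..W. cell_prob (\<Omega> k) * cell_mean (\<Omega> k))"

definition max_tail_mean :: "nat \<Rightarrow> (nat \<Rightarrow> real set) \<Rightarrow> real" where
  "max_tail_mean W \<Omega> = (MAX i\<in>{1..W}. tail_mean W \<Omega> i)"


subsection \<open>Linearisation of the square root\<close>

definition breakpoint :: "real \<Rightarrow> nat \<Rightarrow> nat \<Rightarrow> real" where
  "breakpoint Vmax Q k = real k * (Vmax / real Q)"

text \<open>The segment containing \<open>v\<close> is selected by its right end; at a breakpoint shared by two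
  segments both give the same value (see \<open>sqrt_interp_segment\<close>).\<close>

definition sqrt_interp :: "real \<Rightarrow> nat \<Rightarrow> real \<Rightarrow> real" where
  "sqrt_interp Vmax Q v =
     (let b = breakpoint Vmax Q; k = (LEAST k. 1 \<le> k \<and> v \<le> b k)
      in sqrt (b (k - 1)) + (sqrt (b k) - sqrt (b (k - 1))) / (b k - b (k - 1)) * (v - b (k - 1)))"

text \<open>Both the vertical shift that turns the interpolant into an upper bound of the square root
  and the worst-case deviation of either bound.\<close>

definition sqrt_err :: "real \<Rightarrow> nat \<Rightarrow> real" where
  "sqrt_err Vmax Q = sqrt (Vmax / real Q) / 4"

lemma sqrt_interp_segment:
  assumes V: "0 < Vmax" and k: "k \<in> {1..Q}"
    and v: "v \<in> {breakpoint Vmax Q (k - 1)..breakpoint Vmax Q k}"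
  shows "sqrt_interp Vmax Q v =
    sqrt (breakpoint Vmax Q (k - 1)) +
    (sqrt (breakpoint Vmax Q k) - sqrt (breakpoint Vmax Q (k - 1))) /
      (breakpoint Vmax Q k - breakpoint Vmax Q (k - 1)) * (v - breakpoint Vmax Q (k - 1))"
proof -
  define b where "b = breakpoint Vmax Q"
  have s: "0 < Vmax / real Q" using V k by auto
  have mono: "b i < b j \<longleftrightarrow> i < j" for i j
    unfolding b_def breakpoint_def using s by (metis mult_less_cancel_right_pos of_nat_less_iff)
  have mono': "b i \<le> b j \<longleftrightarrow> i \<le> j" for i j
    using mono[of j i] by linarith
  have v': "b (k - 1) \<le> v" "v \<le> b k" using v by (auto simp: b_def)
  show ?thesis
  proof (cases "v = b (k - 1) \<and> 1 < k")
    case False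
    have "(LEAST j. 1 \<le> j \<and> v \<le> b j) = k"
    proof (rule Least_equality)
      show "1 \<le> k \<and> v \<le> b k" using k v' by auto
      fix j assume j: "1 \<le> j \<and> v \<le> b j"
      show "k \<le> j"
      proof (rule ccontr)
        assume "\<not> k \<le> j"
        then have "1 < k" "b j \<le> b (k - 1)" using j by (auto simp: mono')
        with j v' False show False by auto
      qed
    qed
    then show ?thesis by (simp add: sqrt_interp_def Let_def flip: b_def)
  next
    case True
    have "(LEAST j. 1 \<le> j \<and> v \<le> b j) = k - 1"
    proof (rule Least_equality)
      show "1 \<le> k - 1 \<and> v \<le> b (k - 1)" using True by auto
      fix j assume j: "1 \<le> j \<and> v \<le> b j"
      then show "k - 1 \<le> j" using True mono' by auto
    qed
    moreover have "b (k - 1 - 1) < b (k - 1)" using True by (subst mono) auto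
    ultimately show ?thesis using True by (simp add: sqrt_interp_def Let_def flip: b_def)
  qed
qed


subsection \<open>The two approximating models\<close>

definition lower_feasible ::
  "real ^ 'n \<Rightarrow> real ^ 'n \<Rightarrow> real \<Rightarrow> real \<Rightarrow> nat \<Rightarrow> (nat \<Rightarrow> real set) \<Rightarrow> nat
     \<Rightarrow> real ^ 'n \<Rightarrow> real \<Rightarrow> bool" where
  "lower_feasible \<mu> \<sigma> C Vmax W \<Omega> Q x P \<longleftrightarrow>
     x \<in> binary_vecs \<and>
     (let M = x \<bullet> \<mu>; V = x \<bullet> variances \<sigma>; S = sqrt_interp Vmax Q V + sqrt_err Vmax Q
      in (\<forall>i\<in>{1..W}. P \<ge> S * tail_mean W \<Omega> i - (C - M) * tail_prob W \<Omega> i + loss_err W \<Omega> * S)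
         \<and> P \<ge> loss_err W \<Omega> * S)"

definition upper_feasible ::
  "real ^ 'n \<Rightarrow> real ^ 'n \<Rightarrow> real \<Rightarrow> real \<Rightarrow> nat \<Rightarrow> (nat \<Rightarrow> real set) \<Rightarrow> nat
     \<Rightarrow> real ^ 'n \<Rightarrow> real \<Rightarrow> bool" where
  "upper_feasible \<mu> \<sigma> C Vmax W \<Omega> Q x P \<longleftrightarrow>
     x \<in> binary_vecs \<and>
     (let M = x \<bullet> \<mu>; V = x \<bullet> variances \<sigma>; S = sqrt_interp Vmax Q V
      in (\<forall>i\<in>{1..W}. P \<ge> S * tail_mean W \<Omega> i - (C - M) * tail_prob W \<Omega> i)
         \<and> P \<ge> 0)"

definition lower_value ::
  "real ^ 'n \<Rightarrow> real \<Rightarrow> real ^ 'n \<Rightarrow> real ^ 'n \<Rightarrow> real \<Rightarrow> real \<Rightarrow> nat \<Rightarrow> (nat \<Rightarrow> real set) \<Rightarrow> nat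
     \<Rightarrow> real" where
  "lower_value r c \<mu> \<sigma> C Vmax W \<Omega> Q =
     (GREATEST z. \<exists>x P. lower_feasible \<mu> \<sigma> C Vmax W \<Omega> Q x P \<and> z = r \<bullet> x - c * P)"

definition upper_value ::
  "real ^ 'n \<Rightarrow> real \<Rightarrow> real ^ 'n \<Rightarrow> real ^ 'n \<Rightarrow> real \<Rightarrow> real \<Rightarrow> nat \<Rightarrow> (nat \<Rightarrow> real set) \<Rightarrow> nat
     \<Rightarrow> real" where
  "upper_value r c \<mu> \<sigma> C Vmax W \<Omega> Q =
     (GREATEST z. \<exists>x P. upper_feasible \<mu> \<sigma> C Vmax W \<Omega> Q x P \<and> z = r \<bullet> x - c * P)"

end

theory Submission imports Defs begin

text \<open>For a fixed selection the total weight is normal with mean \<open>M\<close> and variance \<open>V\<close>, so the true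
  expected shortage is \<open>G(\<surd>V)\<close> with \<open>G(S) = E[max(SZ - (C - M), 0)]\<close>. Jensen's inequality on every
  cell gives a lower bound \<open>J(S)\<close>, and rescaling the loss function gives
  \<open>J(S) \<le> G(S) \<le> J(S) + e S\<close>, where \<open>e\<close> is the maximal loss error. Since the cell means increase,
  \<open>J\<close> is the maximum of \<open>0\<close> and the linear functions of the models, whose slopes \<open>A\<^sub>i\<close> lie between
  \<open>0\<close> and \<open>A\<^sub>m\<^sub>a\<^sub>x\<close>; hence \<open>J\<close> is increasing and \<open>A\<^sub>m\<^sub>a\<^sub>x\<close>-Lipschitz in \<open>S\<close>. The optimal penalties
  \<open>J(\<psi>(V))\<close> and \<open>J(\<psi>(V) + \<Delta>) + e (\<psi>(V) + \<Delta>)\<close> thus enclose \<open>G(\<surd>V)\<close> within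
  \<open>(A\<^sub>m\<^sub>a\<^sub>x + e) \<Delta> + e S\<^sub>m\<^sub>a\<^sub>x \<le> \<epsilon> / c\<close>, uniformly over the selections.\<close>

subsection \<open>The interpolant of the square root\<close>

text \<open>With \<open>a\<close>, \<open>b\<close>, \<open>t\<close> the roots of \<open>u\<close>,
  \<open>w\<close>, \<open>v\<close>, the gap between root and chord is
  \<open>(t - a) * (b - t) / (a + b)\<close>. AM-GM on the numerator and
  \<open>b - a \<le> a + b\<close> bound it by \<open>(b - a) / 4\<close>.\<close>

lemma sqrt_chord_bounds:
  fixes u v w :: real
  assumes "0 \<le> u" "u < w" "u \<le> v" "v \<le> w"
  defines "y \<equiv> sqrt u + (sqrt w - sqrt u) / (w - u) * (v - u)"
  shows "0 \<le> y" "y \<le> sqrt v" "sqrt v \<le> y + sqrt (w - u) / 4"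
proof -
  define a b t where "a = sqrt u" and "b = sqrt w" and "t = sqrt v"
  have sq: "u = a\<^sup>2" "w = b\<^sup>2" "v = t\<^sup>2"
    using assms by (auto simp: a_def b_def t_def)
  have ord: "0 \<le> a" "a < b" "a \<le> t" "t \<le> b"
    using assms by (auto simp: a_def b_def t_def)
  have pos: "0 < a + b" using ord by linarith
  have "(b - a) / (b\<^sup>2 - a\<^sup>2) = 1 / (a + b)"
    using ord pos by (simp add: power2_eq_square square_diff_square_factored add.commute)
  then have y: "y = a + (t\<^sup>2 - a\<^sup>2) / (a + b)"
    unfolding y_def a_def[symmetric] b_def[symmetric] unfolding sq by simp
  have "0 \<le> t\<^sup>2 - a\<^sup>2" using ord by (simp add: power_mono)
  then show "0 \<le> y" using y ord pos by simp
  have gap: "t - y = (t - a) * (b - t) / (a + b)"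
    unfolding y using pos by (simp add: field_simps power2_eq_square)
  have "0 \<le> t - y"
    unfolding gap using ord pos by simp
  then show "y \<le> sqrt v" by (simp add: t_def)
  have "(t - a) * (b - t) \<le> (b - a)\<^sup>2 / 4"
    using zero_le_power2[of "(t - a) - (b - t)"] by (simp add: power2_eq_square algebra_simps)
  also have "\<dots> \<le> (b - a) * (a + b) / 4"
    using ord by (simp add: power2_eq_square)
  finally have "t - y \<le> (b - a) / 4"
    unfolding gap using pos by (simp add: field_simps)
  moreover have "b - a \<le> sqrt (w - u)"
  proof (rule real_le_rsqrt)
    have "(b - a) * (b - a) \<le> (b - a) * (b + a)"
      using ord by (intro mult_left_mono) auto
    then show "(b - a)\<^sup>2 \<le> w - u"
      unfolding sq by (simp add: power2_eq_square algebra_simps)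
  qed
  ultimately show "sqrt v \<le> y + sqrt (w - u) / 4" by (simp add: t_def)
qed

text \<open>The \<open>LEAST\<close> in \<open>sqrt_interp\<close> picks a segment of length
  \<open>Vmax / real Q\<close> that contains \<open>v\<close>, so the chord bounds apply and their
  \<open>sqrt (w - u) / 4\<close> becomes \<open>sqrt_err\<close>.\<close>

lemma sqrt_interp_bounds:
  assumes "0 < Vmax" "0 < Q" "0 \<le> v" "v \<le> Vmax"
  shows "0 \<le> sqrt_interp Vmax Q v" "sqrt_interp Vmax Q v \<le> sqrt v"
    "sqrt v \<le> sqrt_interp Vmax Q v + sqrt_err Vmax Q"
proof -
  define b where "b = breakpoint Vmax Q"
  define k where "k = (LEAST k. 1 \<le> k \<and> v \<le> b k)"
  have s: "0 < Vmax / real Q" using assms by simp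
  have "1 \<le> Q \<and> v \<le> b Q" using assms by (simp add: b_def breakpoint_def)
  then have k: "1 \<le> k" "v \<le> b k" "k \<le> Q"
    unfolding k_def by (metis (mono_tags, lifting) LeastI, metis (mono_tags, lifting) LeastI,
      metis (mono_tags, lifting) Least_le)
  \<comment> \<open>For \<open>k = 1\<close> minimality says nothing, because the
    \<open>LEAST\<close> excludes index 0; there the left end is 0.\<close>
  have low: "b (k - 1) \<le> v"
  proof (cases "k = 1")
    case True
    then show ?thesis using assms by (simp add: b_def breakpoint_def)
  next
    case False
    then have "k - 1 < k" "1 \<le> k - 1" using k by auto
    then show ?thesis
      using not_less_Least[of "k - 1" "\<lambda>k. 1 \<le> k \<and> v \<le> b k"] by (auto simp: k_def)
  qed
  have diff: "b k - b (k - 1) = Vmax / real Q"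
    using k by (simp add: b_def breakpoint_def of_nat_diff field_simps)
  have nn: "0 \<le> b (k - 1)" using assms by (simp add: b_def breakpoint_def)
  have eq: "sqrt_interp Vmax Q v =
      sqrt (b (k - 1)) + (sqrt (b k) - sqrt (b (k - 1))) / (b k - b (k - 1)) * (v - b (k - 1))"
    using sqrt_interp_segment[of Vmax k Q v] assms k low by (simp add: b_def)
  have lt: "b (k - 1) < b k" using diff s by linarith
  show "0 \<le> sqrt_interp Vmax Q v" "sqrt_interp Vmax Q v \<le> sqrt v"
    "sqrt v \<le> sqrt_interp Vmax Q v + sqrt_err Vmax Q"
    using sqrt_chord_bounds[OF nn lt low k(2)] unfolding eq sqrt_err_def diff by auto
qed


subsection \<open>Shortage and its Jensen bound\<close>

interpretation std_normal: real_distribution std_normal_distribution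
  by (rule real_dist_normal_dist)

lemma integrable_std_normal_id [simp, intro]: "integrable std_normal_distribution (\<lambda>z. z)"
  using integrable_std_normal_distribution_moment[of 1] by simp

lemma integral_std_normal_id: "(\<integral>z. z \<partial>std_normal_distribution) = 0"
  using integral_std_normal_distribution_moment_odd[of 1] by simp

lemma integral_std_normal_square: "(\<integral>z. z\<^sup>2 \<partial>std_normal_distribution) = 1"
  using std_normal_distribution_even_moments(1)[of 1] by simp

lemma integrable_std_normal_hinge [simp, intro]:
  "integrable std_normal_distribution (\<lambda>z. max (a * z - b) 0)"
  by (intro integrable_max Bochner_Integration.integrable_diff integrable_mult_right) auto

text \<open>The argument \<open>d\<close> stands for the residual capacity C - M. Unlike
  \<open>S * loss (d / S)\<close>, this form has the right value at \<open>S = 0\<close>, the case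
  of a deterministic total weight.\<close>

definition shortage :: "real \<Rightarrow> real \<Rightarrow> real" where
  "shortage S d = (\<integral>z. max (S * z - d) 0 \<partial>std_normal_distribution)"

definition shortage_lb :: "nat \<Rightarrow> (nat \<Rightarrow> real set) \<Rightarrow> real \<Rightarrow> real \<Rightarrow> real" where
  "shortage_lb W \<Omega> S d = (\<Sum>k=1..W. cell_prob (\<Omega> k) * max (S * cell_mean (\<Omega> k) - d) 0)"

lemma shortage_zero: "shortage 0 d = max (- d) 0"
  using std_normal.prob_space by (simp add: shortage_def)

lemma shortage_scale:
  assumes "0 < S"
  shows "shortage S d = S * loss (d / S)"
proof -
  have "max (S * z - d) 0 = S * max (z - d / S) 0" for z
    using assms by (simp add: max_mult_distrib_left right_diff_distrib)
  then show ?thesis by (simp add: shortage_def loss_def)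
qed

lemma shortage_lb_scale:
  assumes "0 < S"
  shows "shortage_lb W \<Omega> S d = S * loss_lb W \<Omega> (d / S)"
proof -
  have "max (S * m - d) 0 = S * max (m - d / S) 0" for m
    using assms by (simp add: max_mult_distrib_left right_diff_distrib)
  then show ?thesis
    by (simp add: shortage_lb_def loss_lb_def sum_distrib_left mult.left_commute)
qed

section \<open>Continuity and tail decay of the loss function\<close>

lemma loss_lipschitz: "loss y \<le> loss y' + \<bar>y - y'\<bar>"
proof -
  have "loss y \<le> (\<integral>z. max (1 * z - y') 0 + \<bar>y - y'\<bar> \<partial>std_normal_distribution)"
    unfolding loss_def using integrable_std_normal_hinge[of 1]
    by (intro integral_mono Bochner_Integration.integrable_add integrable_std_normal_hinge) auto
  also have "\<dots> = loss y' + \<bar>y - y'\<bar>"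
    using integrable_std_normal_hinge[of 1] std_normal.prob_space by (simp add: loss_def)
  finally show ?thesis .
qed

lemma continuous_loss: "continuous_on A loss"
  unfolding continuous_on_iff
proof (intro ballI allI impI)
  fix x e :: real assume "0 < e"
  have "dist (loss x') (loss x) \<le> dist x' x" for x'
    using loss_lipschitz[of x x'] loss_lipschitz[of x' x] by (auto simp: dist_real_def)
  with \<open>0 < e\<close> show "\<exists>d>0. \<forall>x'\<in>A. dist x' x < d \<longrightarrow> dist (loss x') (loss x) < e"
    by (meson order_le_less_trans)
qed

text \<open>The parabola touches the line \<open>z - y\<close> at \<open>z = 2 * y\<close>.
  Integrated, it turns the unit second moment into the tail bound
  \<open>1 / (4 * y)\<close>.\<close>

lemma hinge_le_square: "0 < y \<Longrightarrow> max (z - y) 0 \<le> z\<^sup>2 / (4 * y)" for y z :: real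
proof -
  assume y: "0 < y"
  have "(z - y) * (4 * y) \<le> z\<^sup>2"
    using zero_le_power2[of "z - 2 * y"] by (simp add: power2_eq_square algebra_simps)
  with y show ?thesis by (simp add: field_simps)
qed

lemma integrable_std_normal_square_scaled:
  "integrable std_normal_distribution (\<lambda>z. z\<^sup>2 / a)"
  using integrable_std_normal_distribution_moment[of 2] by simp

lemma loss_upper_tail:
  assumes "0 < y"
  shows "loss y \<le> 1 / (4 * y)"
proof -
  have "loss y \<le> (\<integral>z. z\<^sup>2 / (4 * y) \<partial>std_normal_distribution)"
    unfolding loss_def using integrable_std_normal_hinge[of 1] hinge_le_square[OF assms]
    by (intro integral_mono integrable_std_normal_square_scaled) auto
  then show ?thesis using integral_std_normal_square by simp
qed

text \<open>The positive part of \<open>z + y\<close> is \<open>z + y\<close> plus its negative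
  part, which the parabola bounds at \<open>- z\<close>; the mean of \<open>z + y\<close> is
  \<open>y\<close>.\<close>

lemma loss_lower_tail:
  assumes "0 < y"
  shows "loss (- y) \<le> y + 1 / (4 * y)"
proof -
  have "max (z + y) 0 \<le> z + y + z\<^sup>2 / (4 * y)" for z
    using hinge_le_square[OF assms, of "- z"] by (auto simp: max_def split: if_splits)
  then have "loss (- y) \<le> (\<integral>z. z + y + z\<^sup>2 / (4 * y) \<partial>std_normal_distribution)"
    unfolding loss_def using integrable_std_normal_hinge[of 1 "- y"]
    by (intro integral_mono Bochner_Integration.integrable_add integrable_std_normal_square_scaled) auto
  also have "\<dots> = (\<integral>z. z + y \<partial>std_normal_distribution) + (\<integral>z. z\<^sup>2 / (4 * y) \<partial>std_normal_distribution)"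
    by (intro Bochner_Integration.integral_add Bochner_Integration.integrable_add
        integrable_std_normal_square_scaled) auto
  also have "\<dots> = y + 1 / (4 * y)"
    using integral_std_normal_square integral_std_normal_id std_normal.prob_space by simp
  finally show ?thesis .
qed

text \<open>Outside a compact interval \<open>f\<close> stays below a positive value
  \<open>f y0\<close>. The interval must contain \<open>y0\<close>, so the maximum over it is
  global.\<close>

lemma continuous_attains_sup_vanishing:
  fixes f :: "real \<Rightarrow> real"
  assumes cont: "continuous_on UNIV f" and nonneg: "\<And>y. 0 \<le> f y"
    and vanish: "\<And>e. 0 < e \<Longrightarrow> \<exists>B. \<forall>y. B < \<bar>y\<bar> \<longrightarrow> f y < e"
  shows "\<exists>x. \<forall>y. f y \<le> f x"
proof (cases "\<forall>y. f y = 0")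
  case True
  then show ?thesis by auto
next
  case False
  then obtain y0 where y0: "0 < f y0" using nonneg by (metis order_le_less)
  then obtain B where B: "\<And>y. B < \<bar>y\<bar> \<Longrightarrow> f y < f y0" using vanish by metis
  have "y0 \<in> {- B..B}" using B[of y0] by (cases "B < \<bar>y0\<bar>") auto
  then obtain x where x: "x \<in> {- B..B}" "\<And>y. y \<in> {- B..B} \<Longrightarrow> f y \<le> f x"
    using continuous_attains_sup[of "{- B..B}" f] continuous_on_subset[OF cont] by blast
  have "f y \<le> f x" for y
  proof (cases "y \<in> {- B..B}")
    case False
    then have "B < \<bar>y\<bar>" by auto
    then show ?thesis using B[of y] x(2)[OF \<open>y0 \<in> _\<close>] by linarith
  qed (use x in auto)
  then show ?thesis by blast
qed

section \<open>Cell decomposition of standard normal expectations\<close>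

context
  fixes W :: nat and \<Omega> :: "nat \<Rightarrow> real set"
  assumes W: "0 < W" and part: "ordered_interval_partition W \<Omega>"
begin

lemma cell_measurable: "k \<in> {1..W} \<Longrightarrow> \<Omega> k \<in> sets borel"
  using part by (auto simp: ordered_interval_partition_def intro: real_interval_borel_measurable)

lemma cell_prob_pos: "k \<in> {1..W} \<Longrightarrow> 0 < cell_prob (\<Omega> k)"
  using part by (auto simp: ordered_interval_partition_def cell_prob_def)

lemma cell_less: "\<lbrakk>k \<in> {1..W}; l \<in> {1..W}; k < l; a \<in> \<Omega> k; b \<in> \<Omega> l\<rbrakk> \<Longrightarrow> a < b"
  using part unfolding ordered_interval_partition_def by blast

lemma disjoint_cells: "disjoint_family_on \<Omega> {1..W}"
  unfolding disjoint_family_on_def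
  using cell_less by (metis disjoint_iff less_irrefl linorder_neqE_nat)

lemma cell_set_integrable:
  fixes f :: "real \<Rightarrow> real"
  assumes "k \<in> {1..W}" "integrable std_normal_distribution f"
  shows "set_integrable std_normal_distribution (\<Omega> k) f"
  unfolding set_integrable_def using assms cell_measurable[OF assms(1)]
  by (intro integrable_mult_indicator) auto

lemma integral_eq_sum_cells:
  fixes f :: "real \<Rightarrow> real"
  assumes "integrable std_normal_distribution f"
  shows "(\<integral>z. f z \<partial>std_normal_distribution) = (\<Sum>k=1..W. LINT z:\<Omega> k|std_normal_distribution. f z)"
proof -
  have "(\<integral>z. f z \<partial>std_normal_distribution) = (LINT z:(\<Union>k\<in>{1..W}. \<Omega> k)|std_normal_distribution. f z)"
    using part by (simp add: ordered_interval_partition_def set_lebesgue_integral_def)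
  also have "\<dots> = (\<Sum>k=1..W. LINT z:\<Omega> k|std_normal_distribution. f z)"
    using assms disjoint_cells cell_measurable cell_set_integrable
    by (intro set_integral_finite_Union) auto
  finally show ?thesis .
qed

lemma cell_integral_const:
  "k \<in> {1..W} \<Longrightarrow> (LINT z:\<Omega> k|std_normal_distribution. c) = c * cell_prob (\<Omega> k)" for c :: real
  by (simp add: set_lebesgue_integral_def cell_prob_def)

lemma cell_integral_id:
  "k \<in> {1..W} \<Longrightarrow> (LINT z:\<Omega> k|std_normal_distribution. z) = cell_prob (\<Omega> k) * cell_mean (\<Omega> k)"
  using cell_prob_pos by (fastforce simp: cell_mean_def)

lemma sum_cell_prob: "(\<Sum>k=1..W. cell_prob (\<Omega> k)) = 1"
  using integral_eq_sum_cells[of "\<lambda>_. 1"] std_normal.prob_space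
  by (simp add: cell_integral_const)

lemma sum_cell_mean: "(\<Sum>k=1..W. cell_prob (\<Omega> k) * cell_mean (\<Omega> k)) = 0"
  using integral_eq_sum_cells[of "\<lambda>z. z"] by (simp add: cell_integral_id integral_std_normal_id)

lemma cell_integral_affine:
  assumes "k \<in> {1..W}"
  shows "(LINT z:\<Omega> k|std_normal_distribution. S * z - d) = cell_prob (\<Omega> k) * (S * cell_mean (\<Omega> k) - d)"
proof -
  have "(LINT z:\<Omega> k|std_normal_distribution. S * z - d) =
      (LINT z:\<Omega> k|std_normal_distribution. S * z) - (LINT z:\<Omega> k|std_normal_distribution. d)"
    using assms by (intro set_integral_diff cell_set_integrable) auto
  then show ?thesis
    using assms by (simp add: cell_integral_const cell_integral_id algebra_simps)
qed

text \<open>Jensen on each cell: the integral of the hinge dominates both 0 and the integral of the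
  affine function, and the larger of these is the term of the bound.\<close>

lemma shortage_lb_le: "shortage_lb W \<Omega> S d \<le> shortage S d"
proof -
  have "cell_prob (\<Omega> k) * max (S * cell_mean (\<Omega> k) - d) 0
      \<le> (LINT z:\<Omega> k|std_normal_distribution. max (S * z - d) 0)" if k: "k \<in> {1..W}" for k
  proof -
    have "(LINT z:\<Omega> k|std_normal_distribution. S * z - d) \<le> (LINT z:\<Omega> k|std_normal_distribution. max (S * z - d) 0)"
      using k by (intro set_integral_mono cell_set_integrable) auto
    moreover have "0 \<le> (LINT z:\<Omega> k|std_normal_distribution. max (S * z - d) 0)"
      by (auto simp: set_lebesgue_integral_def intro!: integral_nonneg_AE)
    ultimately show ?thesis
      using cell_prob_pos[OF k] by (auto simp: cell_integral_affine[OF k] max_def)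
  qed
  then have "shortage_lb W \<Omega> S d \<le> (\<Sum>k=1..W. LINT z:\<Omega> k|std_normal_distribution. max (S * z - d) 0)"
    unfolding shortage_lb_def by (intro sum_mono) auto
  then show ?thesis
    unfolding shortage_def by (subst integral_eq_sum_cells) auto
qed

section \<open>The loss gap and its maximum\<close>

lemma loss_lb_le: "loss_lb W \<Omega> y \<le> loss y"
  using shortage_lb_le[of 1 y] by (simp add: shortage_scale shortage_lb_scale)

text \<open>Dropping the positive parts leaves the mean of Z - y, which is \<open>- y\<close>. This
  cancels the linear growth in \<open>loss_lower_tail\<close>.\<close>

lemma neg_le_loss_lb: "- y \<le> loss_lb W \<Omega> y"
proof -
  have "- y = (\<Sum>k=1..W. cell_prob (\<Omega> k) * cell_mean (\<Omega> k)) - y * (\<Sum>k=1..W. cell_prob (\<Omega> k))"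
    by (simp only: sum_cell_mean sum_cell_prob)
  also have "\<dots> = (\<Sum>k=1..W. cell_prob (\<Omega> k) * (cell_mean (\<Omega> k) - y))"
    by (simp add: sum_distrib_left sum_subtractf[symmetric] algebra_simps)
  also have "\<dots> \<le> loss_lb W \<Omega> y"
    unfolding loss_lb_def using cell_prob_pos
    by (intro sum_mono mult_left_mono) (auto intro: less_imp_le)
  finally show ?thesis .
qed

lemma loss_lb_nonneg: "0 \<le> loss_lb W \<Omega> y"
  unfolding loss_lb_def using cell_prob_pos
  by (intro sum_nonneg mult_nonneg_nonneg) (auto intro: less_imp_le)

text \<open>To the right the loss itself is small; to the left the loss and its bound share the
  leading term \<open>- y\<close>. Hence the gap vanishes at infinity.\<close>

lemma loss_gap_tail:
  assumes "y \<noteq> 0"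
  shows "loss y - loss_lb W \<Omega> y \<le> 1 / (4 * \<bar>y\<bar>)"
proof (cases "0 < y")
  case True
  then show ?thesis using loss_upper_tail[of y] loss_lb_nonneg[of y] by simp
next
  case False
  then show ?thesis using assms loss_lower_tail[of "- y"] neg_le_loss_lb[of y] by simp
qed

text \<open>The error maximum defining \<^const>\<open>loss_err\<close> is attained, so the \<^const>\<open>Greatest\<close> is no junk value.\<close>

lemma loss_gap_le: "loss y - loss_lb W \<Omega> y \<le> loss_err W \<Omega>"
proof -
  define f where "f y = loss y - loss_lb W \<Omega> y" for y
  have "\<exists>x. \<forall>y. f y \<le> f x"
  proof (rule continuous_attains_sup_vanishing)
    show "continuous_on UNIV f"
      unfolding f_def loss_lb_def by (intro continuous_intros continuous_loss)
    show "0 \<le> f y" for y using loss_lb_le[of y] by (simp add: f_def)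
    show "\<exists>B. \<forall>y. B < \<bar>y\<bar> \<longrightarrow> f y < e" if e: "0 < e" for e
    proof (intro exI allI impI)
      fix y assume y: "1 / (4 * e) < \<bar>y\<bar>"
      then have "0 < \<bar>y\<bar>" using e by (smt (verit) divide_pos_pos)
      then have "f y \<le> 1 / (4 * \<bar>y\<bar>)" using loss_gap_tail[of y] by (simp add: f_def)
      also have "\<dots> < e" using y e \<open>0 < \<bar>y\<bar>\<close> by (simp add: field_simps)
      finally show "f y < e" .
    qed
  qed
  then obtain x where x: "\<And>y. f y \<le> f x" by blast
  have "loss_err W \<Omega> = f x"
    unfolding loss_err_def by (rule Greatest_equality) (use x in \<open>auto simp: f_def\<close>)
  then show ?thesis using x[of y] by (simp add: f_def)
qed

lemma loss_err_nonneg: "0 \<le> loss_err W \<Omega>"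
  using loss_gap_le[of 0] loss_lb_le[of 0] by simp

lemma shortage_le:
  assumes "0 \<le> S"
  shows "shortage S d \<le> shortage_lb W \<Omega> S d + loss_err W \<Omega> * S"
proof (cases "S = 0")
  case True
  then show ?thesis
    using sum_cell_prob by (simp add: shortage_zero shortage_lb_def flip: sum_distrib_right)
next
  case False
  then have S: "0 < S" using assms by simp
  have "S * (loss (d / S) - loss_lb W \<Omega> (d / S)) \<le> S * loss_err W \<Omega>"
    using S loss_gap_le by (intro mult_left_mono) auto
  then show ?thesis using S by (simp add: shortage_scale shortage_lb_scale algebra_simps)
qed


subsection \<open>The Jensen bound as a maximum of linear functions\<close>

text \<open>Averaging over the lower cell puts its mean below each point of the upper cell;
  averaging over the upper cell then compares the means.\<close>

lemma cell_mean_mono: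
  assumes k: "k \<in> {1..W}" and l: "l \<in> {1..W}" and "k \<le> l"
  shows "cell_mean (\<Omega> k) \<le> cell_mean (\<Omega> l)"
proof (cases "k = l")
  case False
  then have "k < l" using \<open>k \<le> l\<close> by simp
  have mean_le: "cell_mean (\<Omega> k) \<le> b" if b: "b \<in> \<Omega> l" for b
  proof -
    have "(LINT z:\<Omega> k|std_normal_distribution. z) \<le> (LINT z:\<Omega> k|std_normal_distribution. b)"
      using cell_less[OF k l \<open>k < l\<close> _ b] k
      by (intro set_integral_mono cell_set_integrable) (auto intro: less_imp_le)
    then show ?thesis
      using cell_prob_pos[OF k] by (simp add: cell_integral_const[OF k] cell_integral_id[OF k] mult.commute)
  qed
  have "(LINT z:\<Omega> l|std_normal_distribution. cell_mean (\<Omega> k)) \<le> (LINT z:\<Omega> l|std_normal_distribution. z)"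
    using mean_le l by (intro set_integral_mono cell_set_integrable) auto
  then show ?thesis
    using cell_prob_pos[OF l] by (simp add: cell_integral_const[OF l] cell_integral_id[OF l] mult.commute)
qed simp

lemma tail_sum:
  "(\<Sum>k=i..W. cell_prob (\<Omega> k) * (S * cell_mean (\<Omega> k) - d)) = S * tail_mean W \<Omega> i - d * tail_prob W \<Omega> i"
  by (simp add: tail_mean_def tail_prob_def sum_distrib_left sum_subtractf[symmetric] algebra_simps)

lemma shortage_lb_nonneg: "0 \<le> shortage_lb W \<Omega> S d"
  unfolding shortage_lb_def using cell_prob_pos
  by (intro sum_nonneg mult_nonneg_nonneg) (auto intro: less_imp_le)

text \<open>Taking positive parts only raises the terms of the tail, and the cells before
  \<open>i\<close> contribute nonnegative amounts.\<close>

lemma shortage_lb_ge: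
  assumes "i \<in> {1..W}"
  shows "S * tail_mean W \<Omega> i - d * tail_prob W \<Omega> i \<le> shortage_lb W \<Omega> S d"
proof -
  have "(\<Sum>k=i..W. cell_prob (\<Omega> k) * (S * cell_mean (\<Omega> k) - d))
      \<le> (\<Sum>k=i..W. cell_prob (\<Omega> k) * max (S * cell_mean (\<Omega> k) - d) 0)"
    using cell_prob_pos assms by (intro sum_mono mult_left_mono) (auto intro: less_imp_le)
  also have "\<dots> \<le> shortage_lb W \<Omega> S d"
    unfolding shortage_lb_def using cell_prob_pos assms
    by (intro sum_mono2 mult_nonneg_nonneg) (auto intro: less_imp_le)
  finally show ?thesis by (simp add: tail_sum)
qed

text \<open>The cell means increase, so for \<open>S \<ge> 0\<close> the nonvanishing terms of the Jensen bound form a tail.\<close>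

lemma shortage_lb_attained:
  assumes "0 \<le> S"
  shows "shortage_lb W \<Omega> S d = 0 \<or>
    (\<exists>i\<in>{1..W}. shortage_lb W \<Omega> S d = S * tail_mean W \<Omega> i - d * tail_prob W \<Omega> i)"
proof (cases "\<exists>k\<in>{1..W}. 0 \<le> S * cell_mean (\<Omega> k) - d")
  case False
  then show ?thesis by (auto simp: shortage_lb_def max_def intro!: sum.neutral)
next
  case True
  define P where "P k \<longleftrightarrow> k \<in> {1..W} \<and> 0 \<le> S * cell_mean (\<Omega> k) - d" for k
  define i where "i = (LEAST k. P k)"
  have "\<exists>k. P k" using True by (auto simp: P_def)
  then have i: "P i" unfolding i_def by (rule LeastI_ex)
  have below: "\<not> P k" if "k < i" for k using that not_less_Least by (auto simp: i_def)
  have above: "0 \<le> S * cell_mean (\<Omega> k) - d" if "k \<in> {i..W}" for k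
  proof -
    have "S * cell_mean (\<Omega> i) \<le> S * cell_mean (\<Omega> k)"
      using that i assms by (intro mult_left_mono cell_mean_mono) (auto simp: P_def)
    then show ?thesis using i by (simp add: P_def)
  qed
  have "shortage_lb W \<Omega> S d = (\<Sum>k=i..W. cell_prob (\<Omega> k) * max (S * cell_mean (\<Omega> k) - d) 0)"
    unfolding shortage_lb_def
  proof (rule sum.mono_neutral_right)
    show "{i..W} \<subseteq> {1..W}" using i by (auto simp: P_def)
    show "\<forall>k\<in>{1..W} - {i..W}. cell_prob (\<Omega> k) * max (S * cell_mean (\<Omega> k) - d) 0 = 0"
    proof
      fix k assume "k \<in> {1..W} - {i..W}"
      then have "S * cell_mean (\<Omega> k) - d < 0" using below[of k] by (auto simp: P_def)
      then show "cell_prob (\<Omega> k) * max (S * cell_mean (\<Omega> k) - d) 0 = 0" by simp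
    qed
  qed simp
  also have "\<dots> = (\<Sum>k=i..W. cell_prob (\<Omega> k) * (S * cell_mean (\<Omega> k) - d))"
    using above by (intro sum.cong refl) (simp add: max_absorb1)
  finally show ?thesis using i tail_sum by (auto simp: P_def)
qed

text \<open>If the mean of cell \<open>i\<close> is nonnegative, so are all later ones. Otherwise
  all earlier contributions are nonpositive, while the total is the mean 0 of Z.\<close>

lemma tail_mean_nonneg:
  assumes i: "i \<in> {1..W}"
  shows "0 \<le> tail_mean W \<Omega> i"
proof (cases "0 \<le> cell_mean (\<Omega> i)")
  case True
  have "0 \<le> cell_prob (\<Omega> k) * cell_mean (\<Omega> k)" if "k \<in> {i..W}" for k
    using that i True cell_mean_mono[of i k] cell_prob_pos[of k] by auto
  then show ?thesis unfolding tail_mean_def by (rule sum_nonneg)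
next
  case False
  have "cell_prob (\<Omega> k) * cell_mean (\<Omega> k) \<le> 0" if "k \<in> {1..<i}" for k
    using that i False cell_mean_mono[of k i] cell_prob_pos[of k] by (auto simp: mult_le_0_iff)
  then have "(\<Sum>k\<in>{1..<i}. cell_prob (\<Omega> k) * cell_mean (\<Omega> k)) \<le> 0" by (rule sum_nonpos)
  moreover have "{1..W} = {1..<i} \<union> {i..W}" using i by auto
  then have "(\<Sum>k\<in>{1..<i}. cell_prob (\<Omega> k) * cell_mean (\<Omega> k)) + tail_mean W \<Omega> i = 0"
    using sum_cell_mean unfolding tail_mean_def
    by (subst (asm) \<open>{1..W} = _\<close>, subst (asm) sum.union_disjoint) auto
  ultimately show ?thesis by linarith
qed

section \<open>Slopes, monotonicity and Lipschitz continuity of the Jensen bound\<close>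

lemma tail_mean_le_max: "i \<in> {1..W} \<Longrightarrow> tail_mean W \<Omega> i \<le> max_tail_mean W \<Omega>"
  by (simp add: max_tail_mean_def)

lemma max_tail_mean_nonneg: "0 \<le> max_tail_mean W \<Omega>"
  using tail_mean_nonneg[of 1] tail_mean_le_max[of 1] W by auto

text \<open>The linear piece active at \<open>S\<close> has nonnegative slope, and its value at
  \<open>S'\<close> is still below the bound.\<close>

lemma shortage_lb_mono:
  assumes "0 \<le> S" "S \<le> S'"
  shows "shortage_lb W \<Omega> S d \<le> shortage_lb W \<Omega> S' d"
  using shortage_lb_attained[OF assms(1), of d]
proof
  assume "shortage_lb W \<Omega> S d = 0"
  then show ?thesis using shortage_lb_nonneg by simp
next
  assume "\<exists>i\<in>{1..W}. shortage_lb W \<Omega> S d = S * tail_mean W \<Omega> i - d * tail_prob W \<Omega> i"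
  then obtain i where i: "i \<in> {1..W}" "shortage_lb W \<Omega> S d = S * tail_mean W \<Omega> i - d * tail_prob W \<Omega> i"
    by blast
  have "S * tail_mean W \<Omega> i \<le> S' * tail_mean W \<Omega> i"
    using assms(2) tail_mean_nonneg[OF i(1)] by (rule mult_right_mono)
  then show ?thesis using shortage_lb_ge[OF i(1), of S' d] i(2) by linarith
qed

text \<open>Follow the piece active at the larger point \<open>S'\<close> back to \<open>S\<close>:
  it drops by at most \<open>max_tail_mean\<close> times the distance and stays below the bound at
  \<open>S\<close>.\<close>

lemma shortage_lb_lipschitz:
  assumes "0 \<le> S" "S \<le> S'"
  shows "shortage_lb W \<Omega> S' d \<le> shortage_lb W \<Omega> S d + max_tail_mean W \<Omega> * (S' - S)"
proof -
  have nn: "0 \<le> max_tail_mean W \<Omega> * (S' - S)" using assms max_tail_mean_nonneg by simp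
  have "0 \<le> S'" using assms by simp
  then consider "shortage_lb W \<Omega> S' d = 0"
    | i where "i \<in> {1..W}" "shortage_lb W \<Omega> S' d = S' * tail_mean W \<Omega> i - d * tail_prob W \<Omega> i"
    using shortage_lb_attained[of S' d] by blast
  then show ?thesis
  proof cases
    case 1
    then show ?thesis using shortage_lb_nonneg[of S d] nn by linarith
  next
    case 2
    have "(S' - S) * tail_mean W \<Omega> i \<le> (S' - S) * max_tail_mean W \<Omega>"
      using assms tail_mean_le_max[OF 2(1)] by (intro mult_left_mono) auto
    then show ?thesis using shortage_lb_ge[OF 2(1), of S d] 2(2) by (simp add: algebra_simps)
  qed
qed

text \<open>For a fixed selection the constraints on \<open>P\<close> in the models thus describe a
  half-line, whose end is the optimal penalty.\<close>

lemma shortage_lb_le_iff: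
  assumes "0 \<le> S"
  shows "shortage_lb W \<Omega> S d \<le> P \<longleftrightarrow>
    (\<forall>i\<in>{1..W}. S * tail_mean W \<Omega> i - d * tail_prob W \<Omega> i \<le> P) \<and> 0 \<le> P"
proof
  assume "shortage_lb W \<Omega> S d \<le> P"
  then show "(\<forall>i\<in>{1..W}. S * tail_mean W \<Omega> i - d * tail_prob W \<Omega> i \<le> P) \<and> 0 \<le> P"
    using shortage_lb_ge shortage_lb_nonneg order_trans by meson
next
  assume "(\<forall>i\<in>{1..W}. S * tail_mean W \<Omega> i - d * tail_prob W \<Omega> i \<le> P) \<and> 0 \<le> P"
  then show "shortage_lb W \<Omega> S d \<le> P" using shortage_lb_attained[OF assms, of d] by metis
qed

end


subsection \<open>Expected shortage of a selection\<close>

lemma finite_binary_vecs: "finite (binary_vecs :: (real ^ 'n) set)"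
proof -
  have "(binary_vecs :: (real ^ 'n) set) \<subseteq> (\<lambda>f. \<chi> i. f i) ` (UNIV \<rightarrow>\<^sub>E {0, 1})"
  proof
    fix x :: "real ^ 'n" assume "x \<in> binary_vecs"
    then have "($) x \<in> UNIV \<rightarrow>\<^sub>E {0, 1}" by (auto simp: binary_vecs_def)
    moreover have "x = (\<chi> i. x $ i)" by simp
    ultimately show "x \<in> (\<lambda>f. \<chi> i. f i) ` (UNIV \<rightarrow>\<^sub>E {0, 1})" by blast
  qed
  then show ?thesis by (rule finite_subset) (intro finite_imageI finite_PiE; simp)
qed

lemma binary_vecs_nonempty: "(binary_vecs :: (real ^ 'n) set) \<noteq> {}"
proof -
  have "(0 :: real ^ 'n) \<in> binary_vecs" by (simp add: binary_vecs_def)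
  then show ?thesis by blast
qed

lemma inner_binary_vec:
  assumes "x \<in> binary_vecs"
  shows "y \<bullet> x = (\<Sum>i | x $ i = 1. y $ i)"
proof -
  have "y \<bullet> x = (\<Sum>i\<in>UNIV. y $ i * x $ i)" by (simp add: inner_vec_def)
  also have "\<dots> = (\<Sum>i\<in>UNIV. if x $ i = 1 then y $ i else 0)"
    using assms by (intro sum.cong) (auto simp: binary_vecs_def)
  finally show ?thesis by (simp add: sum.If_cases)
qed

text \<open>Standardisation: \<open>X\<close> is \<open>m + s * Z\<close> in law, so the mean moves
  into the capacity.\<close>

lemma (in prob_space) expected_shortage_normal:
  assumes X: "distributed M lborel X (normal_density m s)" and s: "0 < s"
  shows "(\<integral>\<omega>. max (X \<omega> - C) 0 \<partial>M) = shortage s (C - m)"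
proof -
  have "distributed M lborel (\<lambda>\<omega>. (X \<omega> - m) / s) std_normal_density"
    using X normal_standard_normal_convert[OF s] by blast
  then have "(\<integral>z. std_normal_density z * max (s * z - (C - m)) 0 \<partial>lborel) =
      (\<integral>\<omega>. max (s * ((X \<omega> - m) / s) - (C - m)) 0 \<partial>M)"
    by (rule distributed_integral) (auto simp: normal_density_nonneg)
  also have "\<dots> = (\<integral>\<omega>. max (X \<omega> - C) 0 \<partial>M)" using s by simp
  finally show ?thesis
    unfolding shortage_def by (subst integral_density) (auto simp: normal_density_nonneg)
qed

text \<open>Deterministic weights are split off, since \<open>sum_indep_normal\<close> needs positive deviations.\<close>

lemma (in prob_space) expected_shortage_sum:
  assumes I: "finite I" and indep: "indep_vars (\<lambda>_. borel) X I"
    and s: "\<And>i. i \<in> I \<Longrightarrow> 0 \<le> s i"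
    and law: "\<And>i. i \<in> I \<Longrightarrow> distr M borel (X i) = normal_law (m i) (s i)"
  shows "(\<integral>\<omega>. max ((\<Sum>i\<in>I. X i \<omega>) - C) 0 \<partial>M) = shortage (sqrt (\<Sum>i\<in>I. (s i)\<^sup>2)) (C - (\<Sum>i\<in>I. m i))"
proof -
  define D where "D = {i\<in>I. s i = 0}"
  define N where "N = {i\<in>I. s i \<noteq> 0}"
  have sub: "N \<subseteq> I" "D \<subseteq> I" and fin: "finite N" "finite D" using I by (auto simp: D_def N_def)
  have split: "sum f I = sum f N + sum f D" for f :: "_ \<Rightarrow> real"
  proof -
    have "I = N \<union> D" "N \<inter> D = {}" by (auto simp: D_def N_def)
    then show ?thesis using fin by (simp add: sum.union_disjoint)
  qed
  have X[measurable]: "X i \<in> borel_measurable M" if "i \<in> I" for i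
    using indep that by (auto simp: indep_vars_def)
  have "AE \<omega> in M. X i \<omega> = m i" if i: "i \<in> D" for i
  proof -
    have "distr M borel (X i) = return borel (m i)"
      using law[of i] i by (simp add: D_def normal_law_def)
    moreover have "AE z in return borel (m i). z = m i" by (subst AE_return) auto
    ultimately have "AE z in distr M borel (X i). z = m i" by (simp only:)
    then show ?thesis using X[of i] i by (subst (asm) AE_distr_iff) (auto simp: D_def)
  qed
  then have "AE \<omega> in M. \<forall>i\<in>D. X i \<omega> = m i" using fin by (simp add: AE_finite_all)
  \<comment> \<open>The weights in \<open>D\<close> are almost surely constant, so their sum is
    charged to the capacity.\<close>
  then have AE: "AE \<omega> in M. max ((\<Sum>i\<in>I. X i \<omega>) - C) 0 = max ((\<Sum>i\<in>N. X i \<omega>) - (C - sum m D)) 0"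
    by eventually_elim (simp add: split algebra_simps)
  have meas: "(\<lambda>\<omega>. \<Sum>i\<in>J. X i \<omega>) \<in> borel_measurable M" if "J \<subseteq> I" for J
    using that X by (intro borel_measurable_sum) auto
  have "(\<integral>\<omega>. max ((\<Sum>i\<in>I. X i \<omega>) - C) 0 \<partial>M) = (\<integral>\<omega>. max ((\<Sum>i\<in>N. X i \<omega>) - (C - sum m D)) 0 \<partial>M)"
    using meas[of I] meas[OF sub(1)] by (intro integral_cong_AE AE) auto
  also have "\<dots> = shortage (sqrt (\<Sum>i\<in>N. (s i)\<^sup>2)) ((C - sum m D) - sum m N)"
  proof (cases "N = {}")
    \<comment> \<open>No random weight is left; the deviation is \<open>sqrt 0\<close>, which
      \<open>shortage_zero\<close> covers.\<close>
    case True
    then show ?thesis using prob_space by (simp add: shortage_zero)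
  next
    case False
    have pos: "0 < s i" if "i \<in> N" for i using that s[of i] by (auto simp: N_def less_le)
    have "distributed M lborel (\<lambda>\<omega>. \<Sum>i\<in>N. X i \<omega>) (normal_density (\<Sum>i\<in>N. m i) (sqrt (\<Sum>i\<in>N. (s i)\<^sup>2)))"
    proof (rule sum_indep_normal)
      show "indep_vars (\<lambda>_. borel) X N" using indep sub(1) by (rule indep_vars_subset)
      show "distributed M lborel (X i) (normal_density (m i) (s i))" if i: "i \<in> N" for i
      proof -
        \<comment> \<open>\<open>distributed\<close> is taken over \<open>lborel\<close>, the
          hypothesis over \<open>borel\<close>; the two have the same measurable sets.\<close>
        have "distr M lborel (X i) = distr M borel (X i)" by (rule distr_cong) auto
        also have "\<dots> = density lborel (normal_density (m i) (s i))"
          using law[of i] i by (auto simp: N_def normal_law_def)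
        finally show ?thesis using X[of i] i by (auto simp: distributed_def N_def)
      qed
    qed (use fin False pos in auto)
    moreover have "0 < sqrt (\<Sum>i\<in>N. (s i)\<^sup>2)"
      unfolding real_sqrt_gt_0_iff using fin False pos by (intro sum_pos zero_less_power)
    ultimately show ?thesis by (rule expected_shortage_normal)
  qed
  also have "(\<Sum>i\<in>N. (s i)\<^sup>2) = (\<Sum>i\<in>I. (s i)\<^sup>2)" by (simp add: split D_def)
  also have "(C - sum m D) - sum m N = C - (\<Sum>i\<in>I. m i)" by (simp add: split)
  finally show ?thesis .
qed


subsection \<open>Optimal values\<close>

text \<open>As \<open>c\<close> is positive, the best \<open>P\<close> for a given \<open>x\<close>
  is the least admissible one, \<open>p x\<close>. The joint maximum becomes a finite one, so it is
  attained and \<open>GREATEST\<close> denotes it.\<close>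

lemma Greatest_penalised_value:
  fixes g :: "'b \<Rightarrow> real"
  assumes fin: "finite A" "A \<noteq> {}" and c: "0 < c"
    and feas: "\<And>x P. F x P \<longleftrightarrow> x \<in> A \<and> p x \<le> P"
  shows "(GREATEST z. \<exists>x P. F x P \<and> z = g x - c * P) = (MAX x\<in>A. g x - c * p x)"
proof (rule Greatest_equality)
  have "(MAX x\<in>A. g x - c * p x) \<in> (\<lambda>x. g x - c * p x) ` A" using fin by (intro Max_in) auto
  then show "\<exists>x P. F x P \<and> (MAX x\<in>A. g x - c * p x) = g x - c * P" using feas by auto
next
  fix z assume "\<exists>x P. F x P \<and> z = g x - c * P"
  then obtain x P where x: "x \<in> A" "p x \<le> P" "z = g x - c * P" using feas by auto
  have "z \<le> g x - c * p x" using x c by simp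
  also have "\<dots> \<le> (MAX x\<in>A. g x - c * p x)" using x fin by (intro Max_ge) auto
  finally show "z \<le> (MAX x\<in>A. g x - c * p x)" .
qed

lemma Max_image_diff_le:
  fixes f g :: "'b \<Rightarrow> real"
  assumes "finite A" "A \<noteq> {}" "\<And>x. x \<in> A \<Longrightarrow> f x \<le> g x + e"
  shows "(MAX x\<in>A. f x) \<le> (MAX x\<in>A. g x) + e"
proof -
  have "f x \<le> (MAX x\<in>A. g x) + e" if "x \<in> A" for x
    using assms that by (meson Max_ge add_right_mono finite_imageI imageI order_trans)
  then show ?thesis using assms by (simp add: Max_le_iff)
qed

section \<open>Comparison of the three optimal values\<close>

theorem lemma5:
  fixes M :: "'a measure" and \<zeta> :: "'a \<Rightarrow> real ^ 'n" and \<mu> \<sigma> r :: "real ^ 'n"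
    and C c \<epsilon> Vmax :: real and W Q :: nat and \<Omega> :: "nat \<Rightarrow> real set"
  assumes "prob_space M"
    and "prob_space.indep_vars M (\<lambda>_. borel) (\<lambda>i \<omega>. \<zeta> \<omega> $ i) UNIV"
    and "\<And>i. 0 \<le> \<sigma> $ i"
    and "\<And>i. distr M borel (\<lambda>\<omega>. \<zeta> \<omega> $ i) = normal_law (\<mu> $ i) (\<sigma> $ i)"
    and "0 < Vmax" and "\<And>x. x \<in> binary_vecs \<Longrightarrow> x \<bullet> variances \<sigma> \<le> Vmax"
    and "0 < c" and "0 < \<epsilon>" and "0 < W" and "0 < Q"
    and "ordered_interval_partition W \<Omega>"
    and "loss_err W \<Omega> \<le> \<epsilon> / (2 * c * sqrt Vmax)"
    and "sqrt_err Vmax Q \<le> \<epsilon> / (2 * c * (max_tail_mean W \<Omega> + loss_err W \<Omega>))"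
  defines "Zstar \<equiv> true_value M \<zeta> r c C"
    and "ZU \<equiv> upper_value r c \<mu> \<sigma> C Vmax W \<Omega> Q"
    and "ZL \<equiv> lower_value r c \<mu> \<sigma> C Vmax W \<Omega> Q"
  shows "0 \<le> ZU - Zstar \<and> ZU - Zstar \<le> \<epsilon> \<and>
         0 \<le> Zstar - ZL \<and> Zstar - ZL \<le> \<epsilon> \<and>
         ZU - ZL \<le> 2 * \<epsilon>"
proof -
  interpret prob_space M by (rule assms(1))
  note part = \<open>0 < W\<close> \<open>ordered_interval_partition W \<Omega>\<close>
  define e A \<Delta> where "e = loss_err W \<Omega>" and "A = max_tail_mean W \<Omega>" and "\<Delta> = sqrt_err Vmax Q"
  define V :: "real ^ 'n \<Rightarrow> real" where "V x = x \<bullet> variances \<sigma>" for x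
  define d :: "real ^ 'n \<Rightarrow> real" where "d x = C - x \<bullet> \<mu>" for x
  define S :: "real ^ 'n \<Rightarrow> real" where "S x = sqrt_interp Vmax Q (V x)" for x
  \<comment> \<open>\<open>pU\<close> and \<open>pL\<close> are the least admissible penalties of
    the two models, \<open>p\<close> is the true expected shortage.\<close>
  define pU where "pU x = shortage_lb W \<Omega> (S x) (d x)" for x
  define pL where "pL x = shortage_lb W \<Omega> (S x + \<Delta>) (d x) + e * (S x + \<Delta>)" for x
  define p where "p x = shortage (sqrt (V x)) (d x)" for x
  have e: "0 \<le> e" using loss_err_nonneg[OF part] by (simp add: e_def)
  have A: "0 \<le> A" using max_tail_mean_nonneg[OF part] by (simp add: A_def)
  have \<Delta>: "0 < \<Delta>" using \<open>0 < Vmax\<close> \<open>0 < Q\<close> by (simp add: \<Delta>_def sqrt_err_def)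
  \<comment> \<open>Each accuracy hypothesis pays for half of \<open>\<epsilon>\<close>: this one
    for the loss error at deviations up to \<open>sqrt Vmax\<close>, the other one for the square
    root.\<close>
  have e_bound: "c * (e * sqrt Vmax) \<le> \<epsilon> / 2"
    using assms(12) \<open>0 < Vmax\<close> \<open>0 < c\<close> by (simp add: e_def field_simps)
  \<comment> \<open>The denominator is nonzero: division by zero would force \<open>\<Delta> \<le> 0\<close>.\<close>
  have "A + e \<noteq> 0" using assms(13) \<Delta> by (auto simp: A_def e_def \<Delta>_def)
  then have \<Delta>_bound: "c * ((A + e) * \<Delta>) \<le> \<epsilon> / 2"
  proof -
    have "0 < 2 * c * (A + e)" using \<open>A + e \<noteq> 0\<close> A e \<open>0 < c\<close> by simp
    with assms(13) have "\<Delta> * (2 * c * (A + e)) \<le> \<epsilon>"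
      unfolding A_def e_def \<Delta>_def by (simp only: pos_le_divide_eq)
    then show ?thesis by (simp add: algebra_simps)
  qed

  have V: "0 \<le> V x" "V x \<le> Vmax" if "x \<in> binary_vecs" for x
    using that assms(6)[OF that]
    by (auto simp: V_def inner_commute[of x] inner_binary_vec variances_def intro!: sum_nonneg)
  have S: "0 \<le> S x" "S x \<le> sqrt (V x)" "sqrt (V x) \<le> S x + \<Delta>" if "x \<in> binary_vecs" for x
    using sqrt_interp_bounds[OF \<open>0 < Vmax\<close> \<open>0 < Q\<close> V[OF that]] by (auto simp: S_def \<Delta>_def)
  have ZU: "ZU = (MAX x\<in>binary_vecs. r \<bullet> x - c * pU x)"
    unfolding ZU_def upper_value_def
    by (rule Greatest_penalised_value[OF finite_binary_vecs binary_vecs_nonempty \<open>0 < c\<close>])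
      (auto simp: upper_feasible_def Let_def pU_def shortage_lb_le_iff[OF part] S
        simp flip: V_def d_def S_def)
  have ZL: "ZL = (MAX x\<in>binary_vecs. r \<bullet> x - c * pL x)"
    unfolding ZL_def lower_value_def
  proof (rule Greatest_penalised_value[OF finite_binary_vecs binary_vecs_nonempty \<open>0 < c\<close>])
    fix x P
    \<comment> \<open>Moving the error term to the side of \<open>P\<close> leaves the constraints
      of the Jensen bound at the shifted deviation.\<close>
    have "pL x \<le> P \<longleftrightarrow> (\<forall>i\<in>{1..W}. (S x + \<Delta>) * tail_mean W \<Omega> i - d x * tail_prob W \<Omega> i \<le> P - e * (S x + \<Delta>))
        \<and> 0 \<le> P - e * (S x + \<Delta>)" if "x \<in> binary_vecs"
      using S[OF that] \<Delta> shortage_lb_le_iff[OF part, of "S x + \<Delta>" "d x" "P - e * (S x + \<Delta>)"]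
      by (simp add: pL_def le_diff_eq)
    then show "lower_feasible \<mu> \<sigma> C Vmax W \<Omega> Q x P \<longleftrightarrow> x \<in> binary_vecs \<and> pL x \<le> P"
      by (auto simp: lower_feasible_def Let_def le_diff_eq simp flip: V_def d_def S_def \<Delta>_def e_def)
  qed
  have "(\<integral>\<omega>. max (\<zeta> \<omega> \<bullet> x - C) 0 \<partial>M) = p x" if x: "x \<in> binary_vecs" for x
  proof -
    have "(\<integral>\<omega>. max ((\<Sum>i | x $ i = 1. \<zeta> \<omega> $ i) - C) 0 \<partial>M) =
        shortage (sqrt (\<Sum>i | x $ i = 1. (\<sigma> $ i)\<^sup>2)) (C - (\<Sum>i | x $ i = 1. \<mu> $ i))"
      using assms(3,4) indep_vars_subset[OF assms(2)] by (intro expected_shortage_sum) auto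
    then show ?thesis
      using x by (simp add: p_def V_def d_def inner_commute[of x] inner_binary_vec variances_def)
  qed
  then have Zstar: "Zstar = (MAX x\<in>binary_vecs. r \<bullet> x - c * p x)"
    unfolding Zstar_def true_value_def by (intro arg_cong[where f = Max] image_cong) auto

  have bounds: "pU x \<le> p x" "c * p x \<le> c * pU x + \<epsilon>" "p x \<le> pL x" "c * pL x \<le> c * p x + \<epsilon>"
    if x: "x \<in> binary_vecs" for x
  proof -
    let ?J = "\<lambda>S. shortage_lb W \<Omega> S (d x)" and ?S = "sqrt (V x)"
    have S0: "0 \<le> ?S" "?S \<le> sqrt Vmax" using V[OF x] by auto
    have J: "?J ?S \<le> p x" "p x \<le> ?J ?S + e * ?S"
      using shortage_lb_le[OF part] shortage_le[OF part S0(1)] by (auto simp: p_def e_def)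
    have eS: "e * ?S \<le> e * sqrt Vmax" using e S0 by (intro mult_left_mono)
    have "?J (S x) \<le> ?J ?S" using shortage_lb_mono[OF part S(1,2)[OF x]] .
    then show "pU x \<le> p x" using J by (simp add: pU_def)
    have "?J ?S \<le> ?J (S x) + A * (?S - S x)"
      using shortage_lb_lipschitz[OF part S(1,2)[OF x]] by (simp add: A_def)
    also have "A * (?S - S x) \<le> A * \<Delta>" using S(3)[OF x] A by (intro mult_left_mono) auto
    \<comment> \<open>The added \<open>e * \<Delta>\<close> is slack here; it lets
      \<open>\<Delta>_bound\<close> serve both models.\<close>
    also have "A * \<Delta> \<le> (A + e) * \<Delta>" using e \<Delta> by (simp add: algebra_simps)
    finally have "p x \<le> pU x + (A + e) * \<Delta> + e * sqrt Vmax"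
      using J eS by (simp add: pU_def)
    then have "c * p x \<le> c * (pU x + (A + e) * \<Delta> + e * sqrt Vmax)"
      using \<open>0 < c\<close> by simp
    then show "c * p x \<le> c * pU x + \<epsilon>" using \<Delta>_bound e_bound by (simp add: distrib_left)
    \<comment> \<open>Both terms of the upper estimate of \<open>p x\<close> grow when the true
      deviation is replaced by the shifted interpolant above it.\<close>
    have "?J ?S \<le> ?J (S x + \<Delta>)" using shortage_lb_mono[OF part S0(1) S(3)[OF x]] .
    moreover have "e * ?S \<le> e * (S x + \<Delta>)" using e S(3)[OF x] by (rule mult_left_mono[rotated])
    ultimately show "p x \<le> pL x" using J by (simp add: pL_def)
    have "?J (S x + \<Delta>) \<le> ?J ?S + A * (S x + \<Delta> - ?S)"
      using shortage_lb_lipschitz[OF part S0(1) S(3)[OF x]] by (simp add: A_def)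
    also have "A * (S x + \<Delta> - ?S) \<le> A * \<Delta>" using S(2)[OF x] A by (intro mult_left_mono) auto
    finally have "?J (S x + \<Delta>) \<le> p x + A * \<Delta>" using J by simp
    \<comment> \<open>Here \<open>e * \<Delta>\<close> is a real cost, as the error term is charged
      at the shifted deviation; hence \<open>A + e\<close> in the second hypothesis.\<close>
    moreover have "e * (S x + \<Delta>) \<le> e * sqrt Vmax + e * \<Delta>"
      using mult_left_mono[OF order_trans[OF S(2)[OF x] S0(2)] e] by (simp add: distrib_left)
    ultimately have "pL x \<le> p x + (A + e) * \<Delta> + e * sqrt Vmax"
      by (simp add: pL_def algebra_simps)
    then have "c * pL x \<le> c * (p x + (A + e) * \<Delta> + e * sqrt Vmax)"
      using \<open>0 < c\<close> by simp
    then show "c * pL x \<le> c * p x + \<epsilon>" using \<Delta>_bound e_bound by (simp add: distrib_left)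
  qed
  note Max_le = Max_image_diff_le[OF finite_binary_vecs binary_vecs_nonempty]
  \<comment> \<open>The summand 0 is the error term of \<open>Max_image_diff_le\<close>; smaller
    penalties give larger values, so the order of penalties is reversed.\<close>
  have "Zstar \<le> ZU + 0"
    unfolding Zstar ZU using bounds(1) \<open>0 < c\<close> by (intro Max_le) simp
  moreover have "ZU \<le> Zstar + \<epsilon>"
    unfolding Zstar ZU by (intro Max_le) (use bounds(2) in force)
  moreover have "ZL \<le> Zstar + 0"
    unfolding Zstar ZL using bounds(3) \<open>0 < c\<close> by (intro Max_le) simp
  moreover have "Zstar \<le> ZL + \<epsilon>"
    unfolding Zstar ZL by (intro Max_le) (use bounds(4) in force)
  ultimately show ?thesis by linarith
qed

end
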